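(* The following infinite-sum representation of $\pi^2$ holds: $$\frac{\pi^2}{10}=\frac1{16}\sum_{n=0}^\infty\frac{4n\big(4n(12n+29)+81\big)+71}{(4n+1)^2(4n+3)^2\,n!}\,\frac{\Gamma\left(2n+\frac12\right)}{\Gamma\left(n+\frac32\right)}\,\Big(\frac1{64}\Big)^n,$$ where $\Gamma$ is the Euler gamma function. *)

theory Defs
  imports "HOL-Analysis.Analysis"
begin

definition pi_sq_term :: "nat \<Rightarrow> real" where
  "pi_sq_term n =
     (4 * real n * (4 * real n * (12 * real n + 29) + 81) + 71)
       / ((4 * real n + 1)\<^sup>2 * (4 * real n + 3)\<^sup>2 * fact n)
     * (Gamma (2 * real n + 1 / 2) / Gamma (real n + 3 / 2))
     * (1 / 64) ^ n"

end

theory Submission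
  imports Defs "HOL-Real_Asymp.Real_Asymp"
begin

text \<open>
  The given series is an alternating central binomial series in disguise. Write
  \<open>b m = (-1/2 gchoose m) / (4 ^ m * (2 * m + 1)\<^sup>2)\<close>. The Gamma quotient in the summand is, up to
  elementary factors, \<open>-1/2 gchoose 2 * n\<close>, and a partial fraction decomposition of the rational
  factor then shows that the \<open>n\<close>-th summand is exactly \<open>16 * (b (2 * n) + b (2 * n + 1))\<close>
  (lemma \<open>pi_sq_term_eq\<close>). It remains to prove \<open>(\<Sum>m. b m) = pi\<^sup>2 / 10\<close> (lemma
  \<open>pi_sq_summand_sums\<close>).

  Dividing the \<open>m\<close>-th coefficient of a series in \<open>z\<^sup>2\<close> by \<open>2 * m + 1\<close> and multiplying the sum by \<open>z\<close>
  amounts to integration from \<open>0\<close> to \<open>z\<close>. Doing this to \<open>1 / sqrt (1 + z\<^sup>2)\<close> gives \<open>arsinh z\<close>; dividing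
  by \<open>z\<close> and doing it again gives the integral of \<open>arsinh z / z\<close>, whose value at \<open>z = 1/2\<close> is half the
  required sum. After the substitution \<open>z = sinh t\<close> the integrand is \<open>t * coth t\<close>, which has
  an elementary antiderivative up to the term \<open>- dilog (exp (- 2 * t)) / 2\<close>
  (lemma \<open>sinh_times_powser_odd_square\<close>).

  The point \<open>sinh t = 1/2\<close> is the one where \<open>exp (- t)\<close> equals \<open>r = (sqrt 5 - 1) / 2\<close>. There the
  dilogarithm is known in closed form: since \<open>1 - r = r\<^sup>2\<close> and \<open>r / (1 + r) = r\<^sup>2\<close>, the reflection,
  squaring and Landen identities are three linear equations between \<open>dilog r\<close>, \<open>dilog (- r)\<close> and
  \<open>dilog (r\<^sup>2)\<close>, with solution \<open>dilog (r\<^sup>2) = pi\<^sup>2 / 15 - (ln r)\<^sup>2\<close> (lemma \<open>dilog_golden\<close>).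
  The logarithms cancel and \<open>- pi\<^sup>2 / 15 + pi\<^sup>2 / 6 = pi\<^sup>2 / 10\<close> is left.
\<close>

section \<open>The real dilogarithm at the golden ratio\<close>

text \<open>The term for \<open>n = 0\<close> vanishes because division by zero yields zero.\<close>

definition dilog :: "real \<Rightarrow> real" where
  "dilog x = (\<Sum>n. 1 / (real n)\<^sup>2 * x ^ n)"

lemma summable_inverse_squares: "summable (\<lambda>n. 1 / (real n)\<^sup>2)"
proof -
  have "summable (\<lambda>n. 1 / (real (Suc n))\<^sup>2)"
    using sums_summable[OF inverse_squares_sums] by (simp add: add_ac)
  thus ?thesis
    by (subst (asm) summable_Suc_iff)
qed

lemma dilog_term_bound:
  assumes "\<bar>x\<bar> \<le> 1"
  shows "norm (1 / (real n)\<^sup>2 * x ^ n) \<le> 1 / (real n)\<^sup>2"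
proof -
  have "\<bar>x\<bar> ^ n \<le> 1"
    using assms by (simp add: power_le_one)
  thus ?thesis
    by (simp add: abs_mult power_abs divide_right_mono)
qed

lemma summable_dilog: "\<bar>x\<bar> \<le> 1 \<Longrightarrow> summable (\<lambda>n. 1 / (real n)\<^sup>2 * x ^ n)"
  by (rule summable_comparison_test'[OF summable_inverse_squares, of 0]) (rule dilog_term_bound)

lemma dilog_0 [simp]: "dilog 0 = 0"
proof -
  have "(\<lambda>n. 1 / (real n)\<^sup>2 * 0 ^ n) = (\<lambda>n. 0)"
    by (auto simp: power_0_left)
  thus ?thesis unfolding dilog_def by simp
qed

lemma dilog_1: "dilog 1 = pi\<^sup>2 / 6"
proof -
  have "(\<lambda>n. 1 / (real (Suc n))\<^sup>2) sums (pi\<^sup>2 / 6)"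
    using inverse_squares_sums by (simp add: add_ac)
  hence "(\<lambda>n. 1 / (real n)\<^sup>2) sums (pi\<^sup>2 / 6)"
    by (subst (asm) sums_Suc_iff) simp
  thus ?thesis
    by (simp add: dilog_def sums_iff)
qed

text \<open>
  The endpoint \<open>1\<close>, where \<open>dilog\<close> takes the value that brings \<open>pi\<close> into play, is not interior to
  the disc of convergence, so power series calculus does not apply there; the uniform bound
  \<open>1 / n\<^sup>2\<close> on the closed interval does.
\<close>

lemma continuous_on_dilog: "continuous_on {-1..1} dilog"
proof (rule uniform_limit_theorem)
  show "uniform_limit {-1..1} (\<lambda>N x. \<Sum>n<N. 1 / (real n)\<^sup>2 * x ^ n) dilog sequentially"
    unfolding dilog_def [abs_def]
    by (rule Weierstrass_m_test[OF dilog_term_bound summable_inverse_squares]) auto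
  show "eventually (\<lambda>N. continuous_on {-1..1} (\<lambda>x. \<Sum>n<N. 1 / (real n)\<^sup>2 * x ^ n)) sequentially"
    by (intro always_eventually allI continuous_on_sum continuous_on_mult continuous_on_const
          continuous_on_power continuous_on_id)
qed simp

lemma isCont_dilog: "\<bar>x\<bar> < 1 \<Longrightarrow> isCont dilog x"
  using continuous_on_interior[OF continuous_on_dilog, of x] by (auto simp: abs_less_iff)

lemma tendsto_dilog_compose:
  assumes "(f \<longlongrightarrow> c) F" "c \<in> {-1..1}" "eventually (\<lambda>x. f x \<in> {-1..1}) F"
  shows "((\<lambda>x. dilog (f x)) \<longlongrightarrow> dilog c) F"
  by (rule continuous_on_tendsto_compose[OF continuous_on_dilog assms])

lemma sums_ln_one_minus:
  fixes x :: real
  assumes "\<bar>x\<bar> < 1"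
  shows "(\<lambda>n. x ^ Suc n / real (Suc n)) sums (- ln (1 - x))"
proof -
  have eq: "(-1) ^ n * (1 / real (n + 1)) * (1 - x - 1) ^ Suc n = - (x ^ Suc n / real (Suc n))" for n
  proof -
    have "(1 - x - 1) ^ Suc n = (-1) ^ Suc n * x ^ Suc n"
      using power_minus[of x "Suc n"] by simp
    moreover have "(-1 :: real) ^ n * (-1) ^ Suc n = -1"
      by (simp flip: power_add)
    ultimately show ?thesis
      by (simp add: field_simps del: power_Suc of_nat_Suc)
  qed
  have "summable (\<lambda>n. x ^ Suc n / real (Suc n))"
  proof (rule summable_comparison_test'[where N = 0])
    show "summable (\<lambda>n. \<bar>x\<bar> ^ n)"
      using assms by (simp add: summable_geometric)
    show "norm (x ^ Suc n / real (Suc n)) \<le> \<bar>x\<bar> ^ n" for n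
    proof -
      have "norm (x ^ Suc n / real (Suc n)) = \<bar>x\<bar> ^ n * (\<bar>x\<bar> / real (Suc n))"
        by (simp add: abs_mult power_abs)
      also have "\<dots> \<le> \<bar>x\<bar> ^ n * 1"
        using assms by (intro mult_left_mono) (auto simp: divide_le_eq)
      finally show ?thesis by simp
    qed
  qed
  moreover have "ln (1 - x) = (\<Sum>n. - (x ^ Suc n / real (Suc n)))"
    using ln_series[of "1 - x"] assms unfolding eq by auto
  ultimately show ?thesis
    by (simp add: sums_iff suminf_minus del: power_Suc of_nat_Suc)
qed

text \<open>
  The point \<open>0\<close> is excluded only because the quotient \<open>- ln (1 - y) / y\<close> has the wrong value there.
\<close>

lemma dilog_has_real_derivative [derivative_intros]:
  assumes "(f has_real_derivative f') (at x within A)" "\<bar>f x\<bar> < 1" "f x \<noteq> 0"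
  shows "((\<lambda>x. dilog (f x)) has_real_derivative (- ln (1 - f x) / f x) * f') (at x within A)"
proof -
  define y where "y = f x"
  have y: "\<bar>y\<bar> < 1" "y \<noteq> 0"
    using assms by (auto simp: y_def)
  have "(dilog has_real_derivative (\<Sum>n. diffs (\<lambda>n. 1 / (real n)\<^sup>2) n * y ^ n)) (at y)"
    unfolding dilog_def [abs_def]
  proof (rule termdiffs_strong'[of 1])
    show "summable (\<lambda>n. 1 / (real n)\<^sup>2 * z ^ n)" if "norm z < 1" for z :: real
      by (rule summable_dilog) (use that in simp)
  qed (use y in simp)
  also have "(\<lambda>n. diffs (\<lambda>n. 1 / (real n)\<^sup>2) n * y ^ n) = (\<lambda>n. y ^ Suc n / real (Suc n) / y)"
    using y by (auto simp: diffs_def field_simps power2_eq_square simp del: of_nat_Suc)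
  also have "(\<Sum>n. y ^ Suc n / real (Suc n) / y) = - ln (1 - y) / y"
    using sums_divide[OF sums_ln_one_minus[OF y(1)], of y] by (simp add: sums_iff)
  finally show ?thesis
    unfolding y_def by (rule DERIV_chain2[OF _ assms(1)])
qed

lemma isCont_imp_at_right:
  fixes f :: "real \<Rightarrow> real"
  assumes "isCont f a" "f a = c"
  shows "(f \<longlongrightarrow> c) (at_right a)"
  using assms filterlim_at_split unfolding isCont_def by blast

text \<open>
  The common pattern of all functional equations below: the difference of both sides has derivative
  zero on an open interval, and the constant is found as a one-sided limit at an endpoint, where
  the logarithms involved may be singular.
\<close>

lemma eq_limit_at_left_endpoint:
  fixes f :: "real \<Rightarrow> real"
  assumes deriv: "\<And>x. a < x \<Longrightarrow> x < b \<Longrightarrow> (f has_real_derivative 0) (at x)"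
    and lim: "(f \<longlongrightarrow> c) (at_right a)"
    and x: "a < x" "x < b"
  shows "f x = c"
proof -
  have "eventually (\<lambda>y. y \<in> {a<..<b}) (at_right a)"
    using x by (intro eventually_at_right_real) auto
  hence "eventually (\<lambda>y. f y = f x) (at_right a)"
    by eventually_elim (rule DERIV_isconst3[of a b], use x deriv in auto)
  hence "(f \<longlongrightarrow> f x) (at_right a)"
    by (rule tendsto_eventually)
  thus ?thesis
    using tendsto_unique lim trivial_limit_at_right_real by blast
qed

lemma dilog_reflection:
  assumes "0 < x" "x < 1"
  shows "dilog x + dilog (1 - x) = pi\<^sup>2 / 6 - ln x * ln (1 - x)"
proof -
  have ev: "eventually (\<lambda>x::real. x \<in> {0<..<1}) (at_right 0)"
    by (intro eventually_at_right_real) auto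
  have "dilog x + dilog (1 - x) + ln x * ln (1 - x) = dilog 0 + dilog (1 - 0) + 0"
  proof (rule eq_limit_at_left_endpoint[where f = "\<lambda>x. dilog x + dilog (1 - x) + ln x * ln (1 - x)" and a = 0 and b = 1])
    fix x :: real assume x: "0 < x" "x < 1"
    show "((\<lambda>x. dilog x + dilog (1 - x) + ln x * ln (1 - x)) has_real_derivative 0) (at x)"
      using x by (auto intro!: derivative_eq_intros simp: divide_simps)
  next
    have "((\<lambda>x::real. ln x * ln (1 - x)) \<longlongrightarrow> 0) (at_right 0)"
      by real_asymp
    moreover have "((\<lambda>x. dilog x) \<longlongrightarrow> dilog 0) (at_right 0)"
      by (rule tendsto_dilog_compose) (auto intro: eventually_mono[OF ev])
    moreover have "((\<lambda>x. dilog (1 - x)) \<longlongrightarrow> dilog (1 - 0)) (at_right 0)"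
      by (rule tendsto_dilog_compose) (auto intro!: tendsto_eq_intros intro: eventually_mono[OF ev])
    ultimately show "((\<lambda>x. dilog x + dilog (1 - x) + ln x * ln (1 - x))
        \<longlongrightarrow> dilog 0 + dilog (1 - 0) + 0) (at_right 0)"
      by (intro tendsto_add)
  qed (use assms in auto)
  thus ?thesis by (simp add: dilog_1)
qed

lemma dilog_square:
  assumes "0 < x" "x < 1"
  shows "dilog (x\<^sup>2) = 2 * (dilog x + dilog (- x))"
proof -
  have "dilog (x\<^sup>2) - 2 * (dilog x + dilog (- x)) = 0"
  proof (rule eq_limit_at_left_endpoint[where f = "\<lambda>x. dilog (x\<^sup>2) - 2 * (dilog x + dilog (- x))" and a = 0 and b = 1])
    fix x :: real assume x: "0 < x" "x < 1"
    have "ln (1 - x\<^sup>2) = ln (1 - x) + ln (1 + x)"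
      using x ln_mult[of "1 - x" "1 + x"] by (simp add: algebra_simps power2_eq_square)
    moreover have "x\<^sup>2 < 1"
      using x by (simp add: power_less_one_iff)
    ultimately show "((\<lambda>x. dilog (x\<^sup>2) - 2 * (dilog x + dilog (- x))) has_real_derivative 0) (at x)"
      using x by (auto intro!: derivative_eq_intros simp: field_simps power2_eq_square)
  next
    have "isCont (\<lambda>x. dilog (x\<^sup>2) - 2 * (dilog x + dilog (- x))) 0"
      by (intro continuous_intros isCont_o2[OF _ isCont_dilog]) auto
    thus "((\<lambda>x. dilog (x\<^sup>2) - 2 * (dilog x + dilog (- x))) \<longlongrightarrow> 0) (at_right 0)"
      by (rule isCont_imp_at_right) simp
  qed (use assms in auto)
  thus ?thesis by simp
qed

lemma dilog_landen:
  assumes "0 < x" "x < 1"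
  shows "dilog (- x) + dilog (x / (1 + x)) = - (ln (1 + x))\<^sup>2 / 2"
proof -
  have "dilog (- x) + dilog (x / (1 + x)) + (ln (1 + x))\<^sup>2 / 2 = 0"
  proof (rule eq_limit_at_left_endpoint[where f = "\<lambda>x. dilog (- x) + dilog (x / (1 + x)) + (ln (1 + x))\<^sup>2 / 2" and a = 0 and b = 1])
    fix x :: real assume x: "0 < x" "x < 1"
    have "1 - x / (1 + x) = 1 / (1 + x)"
      using x by (simp add: field_simps)
    hence "ln (1 - x / (1 + x)) = - ln (1 + x)"
      using x by (simp add: ln_div)
    thus "((\<lambda>x. dilog (- x) + dilog (x / (1 + x)) + (ln (1 + x))\<^sup>2 / 2) has_real_derivative 0) (at x)"
      using x by (auto intro!: derivative_eq_intros simp: divide_simps) (auto simp: algebra_simps)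
  next
    have "isCont (\<lambda>x. dilog (- x) + dilog (x / (1 + x)) + (ln (1 + x))\<^sup>2 / 2) 0"
      by (intro continuous_intros isCont_o2[OF _ isCont_dilog]) auto
    thus "((\<lambda>x. dilog (- x) + dilog (x / (1 + x)) + (ln (1 + x))\<^sup>2 / 2) \<longlongrightarrow> 0) (at_right 0)"
      by (rule isCont_imp_at_right) simp
  qed (use assms in auto)
  thus ?thesis by simp
qed

text \<open>
  The hypothesis makes \<open>1 - r\<close> and \<open>r / (1 + r)\<close> both equal to \<open>r\<^sup>2\<close>, so that the three functional
  equations involve only \<open>dilog r\<close>, \<open>dilog (- r)\<close> and \<open>dilog (r\<^sup>2)\<close> and can be solved.
\<close>

lemma dilog_golden:
  fixes r :: real
  assumes "0 < r" "r\<^sup>2 = 1 - r"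
  shows "dilog (r\<^sup>2) = pi\<^sup>2 / 15 - (ln r)\<^sup>2"
proof -
  have r1: "r < 1"
    using assms zero_less_power[of r 2] by linarith
  have rr: "r * (1 + r) = 1"
    using assms by (simp add: algebra_simps power2_eq_square)
  hence inv: "1 + r = 1 / r"
    using assms(1) by (simp add: field_simps)
  have lnr: "ln (1 + r) = - ln r"
    unfolding inv using assms(1) by (simp add: ln_div)
  have ln2: "ln (r\<^sup>2) = 2 * ln r"
    by (simp only: ln_realpow of_nat_numeral)
  have "dilog r + dilog (r\<^sup>2) = pi\<^sup>2 / 6 - 2 * (ln r)\<^sup>2"
    using dilog_reflection[OF assms(1) r1, folded assms(2)] by (simp add: ln2) (simp add: power2_eq_square)
  moreover have "dilog (r\<^sup>2) = 2 * (dilog r + dilog (- r))"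
    by (rule dilog_square[OF assms(1) r1])
  moreover have "dilog (- r) + dilog (r\<^sup>2) = - (ln r)\<^sup>2 / 2"
    using dilog_landen[OF assms(1) r1] unfolding lnr by (simp add: inv power2_eq_square)
  ultimately show ?thesis by argo
qed

section \<open>A twofold integral of the binomial series\<close>

text \<open>
  The Taylor coefficients, in powers of \<open>z\<^sup>2\<close>, of the derivative \<open>1 / sqrt (1 + z\<^sup>2)\<close> of \<open>arsinh z\<close>;
  equivalently \<open>(-1) ^ n * (2 * n choose n) / 4 ^ n\<close>.
\<close>

definition arsinh_coeff :: "nat \<Rightarrow> real" where
  "arsinh_coeff n = (-1/2) gchoose n"

lemma summable_divide_odd:
  fixes c :: "nat \<Rightarrow> real"
  assumes "\<And>w. \<bar>w\<bar> < 1 \<Longrightarrow> summable (\<lambda>n. c n * w ^ n)" "\<bar>w\<bar> < 1"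
  shows "summable (\<lambda>n. c n / real (2 * n + 1) * w ^ n)"
proof (rule summable_comparison_test'[where N = 0])
  \<comment> \<open>Absolute convergence at \<open>w\<close> comes from convergence at a point further out.\<close>
  obtain u where u: "\<bar>w\<bar> < u" "u < 1"
    using dense[OF assms(2)] by blast
  have "summable (\<lambda>n. c n * u ^ n)"
    using u assms(1)[of u] by simp
  thus "summable (\<lambda>n. norm (c n * w ^ n))"
    by (rule powser_insidea) (use u in auto)
  show "norm (c n / real (2 * n + 1) * w ^ n) \<le> norm (c n * w ^ n)" for n
  proof -
    have "norm (c n / real (2 * n + 1) * w ^ n) = norm (c n * w ^ n) / real (2 * n + 1)"
      by (simp add: abs_mult)
    also have "\<dots> \<le> norm (c n * w ^ n) / 1"
      by (rule divide_left_mono) auto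
    finally show ?thesis by simp
  qed
qed

text \<open>
  Termwise, \<open>c n * z ^ (2 * n + 1) / (2 * n + 1)\<close> is the antiderivative of \<open>c n * (z\<^sup>2) ^ n\<close>. Keeping
  \<open>w = z\<^sup>2\<close> as the variable of the power series avoids interleaving zero coefficients.
\<close>

lemma powser_divide_odd_has_derivative:
  fixes c :: "nat \<Rightarrow> real"
  assumes c: "\<And>w. \<bar>w\<bar> < 1 \<Longrightarrow> summable (\<lambda>n. c n * w ^ n)" and z: "\<bar>z\<bar> < 1"
  shows "((\<lambda>z. z * (\<Sum>n. c n / real (2 * n + 1) * (z\<^sup>2) ^ n)) has_real_derivative
           (\<Sum>n. c n * (z\<^sup>2) ^ n)) (at z)"
proof -
  define d where "d = (\<lambda>n. c n / real (2 * n + 1))"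
  define w where "w = z\<^sup>2"
  have d: "summable (\<lambda>n. d n * w ^ n)" if "\<bar>w\<bar> < 1" for w
    unfolding d_def using summable_divide_odd[OF c] that by blast
  have w: "\<bar>w\<bar> < 1"
    using z by (simp add: w_def abs_square_less_1)
  have D: "((\<lambda>w. \<Sum>n. d n * w ^ n) has_real_derivative (\<Sum>n. diffs d n * w ^ n)) (at w)"
    by (rule termdiffs_strong'[of 1]) (use d w in auto)
  have "summable (\<lambda>n. diffs d n * w ^ n)"
    by (rule termdiff_converges[of _ 1]) (use d w in auto)
  hence "(\<lambda>n. real n * d n * w ^ (n - Suc 0)) sums (\<Sum>n. diffs d n * w ^ n)"
    by (rule diffs_equiv)
  hence "(\<lambda>n. 2 * w * (real n * d n * w ^ (n - Suc 0))) sums (2 * w * (\<Sum>n. diffs d n * w ^ n))"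
    by (rule sums_mult)
  hence "(\<lambda>n. d n * w ^ n + 2 * w * (real n * d n * w ^ (n - Suc 0))) sums
           ((\<Sum>n. d n * w ^ n) + 2 * w * (\<Sum>n. diffs d n * w ^ n))"
    by (intro sums_add summable_sums d w)
  also have "(\<lambda>n. d n * w ^ n + 2 * w * (real n * d n * w ^ (n - Suc 0))) = (\<lambda>n. c n * w ^ n)"
  proof
    fix n
    have "w * (real n * d n * w ^ (n - Suc 0)) = real n * d n * w ^ n"
      by (cases n) auto
    hence "d n * w ^ n + 2 * w * (real n * d n * w ^ (n - Suc 0)) = (real (2 * n + 1) * d n) * w ^ n"
      by (simp add: algebra_simps)
    also have "real (2 * n + 1) * d n = c n"
      by (simp add: d_def)
    finally show "d n * w ^ n + 2 * w * (real n * d n * w ^ (n - Suc 0)) = c n * w ^ n" .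
  qed
  finally have eq: "(\<Sum>n. c n * w ^ n) = (\<Sum>n. d n * w ^ n) + 2 * w * (\<Sum>n. diffs d n * w ^ n)"
    by (simp add: sums_iff)
  have "((\<lambda>z. z\<^sup>2) has_real_derivative 2 * z) (at z)"
    by (auto intro!: derivative_eq_intros)
  from DERIV_chain2[OF D[unfolded w_def] this]
  have "((\<lambda>z. z * (\<Sum>n. d n * (z\<^sup>2) ^ n)) has_real_derivative
          (\<Sum>n. d n * (z\<^sup>2) ^ n) + (\<Sum>n. diffs d n * (z\<^sup>2) ^ n) * (2 * z) * z) (at z)"
    by (rule DERIV_cong[OF DERIV_mult'[OF DERIV_ident]]) simp
  thus ?thesis
    using eq unfolding w_def d_def by (simp add: power2_eq_square mult_ac)
qed

lemma summable_arsinh_coeff: "\<bar>w\<bar> < 1 \<Longrightarrow> summable (\<lambda>n. arsinh_coeff n * w ^ n)"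
  unfolding arsinh_coeff_def using gen_binomial_real sums_summable by blast

lemma isCont_sinh_real: "isCont sinh (x :: real)"
  by (rule DERIV_isCont) (auto intro!: derivative_eq_intros)

lemma sinh_less_1_iff: "sinh t < 1 \<longleftrightarrow> t < arsinh (1 :: real)"
  using sinh_real_less_iff[of t "arsinh 1"] by simp

text \<open>
  This is the Taylor series of \<open>arsinh\<close> evaluated at \<open>sinh t\<close>. In the variable \<open>t\<close> the derivative of the
  left-hand side is \<open>cosh t / sqrt (1 + (sinh t)\<^sup>2) = 1\<close>.
\<close>

lemma sinh_times_powser_odd:
  fixes t :: real
  assumes "0 < t" "sinh t < 1"
  shows "sinh t * (\<Sum>n. arsinh_coeff n / real (2 * n + 1) * ((sinh t)\<^sup>2) ^ n) = t"
proof -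
  let ?f = "\<lambda>z. z * (\<Sum>n. arsinh_coeff n / real (2 * n + 1) * (z\<^sup>2) ^ n)"
  have f: "(?f has_real_derivative (1 + z\<^sup>2) powr (-1/2)) (at z)" if "\<bar>z\<bar> < 1" for z :: real
  proof -
    have "(\<lambda>n. arsinh_coeff n * (z\<^sup>2) ^ n) sums (1 + z\<^sup>2) powr (-1/2)"
      unfolding arsinh_coeff_def
      by (rule gen_binomial_real) (use that in \<open>simp add: abs_square_less_1\<close>)
    thus ?thesis
      using powser_divide_odd_has_derivative[OF summable_arsinh_coeff that] by (simp add: sums_iff)
  qed
  have "?f (sinh t) - t = 0"
  proof (rule eq_limit_at_left_endpoint[where f = "\<lambda>t. ?f (sinh t) - t" and a = 0 and b = "arsinh 1"])
    fix t :: real assume t: "0 < t" "t < arsinh 1"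
    hence st: "\<bar>sinh t\<bar> < 1"
      by (simp add: sinh_less_1_iff)
    have "1 + (sinh t)\<^sup>2 = (cosh t)\<^sup>2"
      by (simp add: cosh_square_eq)
    hence "(1 + (sinh t)\<^sup>2) powr (-1/2) = 1 / cosh t"
      using powr_half_sqrt[of "(cosh t)\<^sup>2"] by (simp add: powr_minus_divide)
    moreover have "((\<lambda>t. ?f (sinh t)) has_real_derivative (1 + (sinh t)\<^sup>2) powr (-1/2) * cosh t) (at t)"
      by (rule DERIV_chain2[where f = ?f and g = sinh, OF f[OF st]]) (auto intro!: derivative_eq_intros)
    ultimately have "((\<lambda>t. ?f (sinh t)) has_real_derivative 1) (at t)"
      by simp
    from DERIV_diff[OF this DERIV_ident]
    show "((\<lambda>t. ?f (sinh t) - t) has_real_derivative 0) (at t)" by simp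
  next
    have "isCont ?f (sinh 0)"
      using f[of 0] DERIV_isCont by fastforce
    hence "isCont (\<lambda>t. ?f (sinh t)) 0"
      by (rule isCont_o2[OF isCont_sinh_real])
    hence "isCont (\<lambda>t. ?f (sinh t) - t) 0"
      by (rule continuous_diff) simp
    thus "((\<lambda>t. ?f (sinh t) - t) \<longlongrightarrow> 0) (at_right 0)"
      by (rule isCont_imp_at_right) simp
  qed (use assms in \<open>simp_all add: sinh_less_1_iff\<close>)
  thus ?thesis by simp
qed

text \<open>
  Both sides are twice the integral of \<open>s * coth s\<close> from \<open>0\<close> to \<open>t\<close>. With \<open>e = exp (- 2 * t)\<close>, the
  right-hand side has this derivative because \<open>coth t = (1 + e) / (1 - e) = 1 + 2 * e / (1 - e)\<close>
  and the logarithms from the product rule and from the dilogarithm cancel. Both sides vanish in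
  the limit at \<open>0\<close> because \<open>dilog 1 = pi\<^sup>2 / 6\<close>.
\<close>

lemma sinh_times_powser_odd_square:
  fixes t :: real
  assumes "0 < t" "sinh t < 1"
  shows "2 * (sinh t * (\<Sum>n. arsinh_coeff n / real (2 * n + 1) / real (2 * n + 1) * ((sinh t)\<^sup>2) ^ n))
           = 2 * t * ln (1 - exp (- 2 * t)) + t\<^sup>2 - dilog (exp (- 2 * t)) + pi\<^sup>2 / 6"
proof -
  define g where "g = (\<lambda>z. z * (\<Sum>n. arsinh_coeff n / real (2 * n + 1) / real (2 * n + 1) * (z\<^sup>2) ^ n))"
  define h where "h = (\<lambda>t. 2 * g (sinh t) - 2 * t * ln (1 - exp (- 2 * t)) - t\<^sup>2 + dilog (exp (- 2 * t)))"
  have g: "(g has_real_derivative (\<Sum>n. arsinh_coeff n / real (2 * n + 1) * (z\<^sup>2) ^ n)) (at z)"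
    if "\<bar>z\<bar> < 1" for z :: real
    unfolding g_def
    by (intro powser_divide_odd_has_derivative summable_divide_odd summable_arsinh_coeff that)
  have "h t = 2 * g (sinh 0) - 0 - 0\<^sup>2 + dilog 1"
  proof (rule eq_limit_at_left_endpoint[where f = h and a = 0 and b = "arsinh 1"])
    fix t :: real assume t: "0 < t" "t < arsinh 1"
    hence st: "0 < sinh t" "sinh t < 1"
      by (simp_all add: sinh_less_1_iff)
    let ?e = "exp (- 2 * t)"
    have "(\<Sum>n. arsinh_coeff n / real (2 * n + 1) * ((sinh t)\<^sup>2) ^ n) = t / sinh t"
      using sinh_times_powser_odd[OF t(1) st(2)] st(1) by (simp add: field_simps)
    with g[of "sinh t"] st have "(g has_real_derivative t / sinh t) (at (sinh t))"
      by simp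
    hence gs: "((\<lambda>t. g (sinh t)) has_real_derivative t / sinh t * cosh t) (at t)"
      by (rule DERIV_chain2) (auto intro!: derivative_eq_intros)
    have e1: "?e < 1"
      using t by simp
    have "?e = exp (- t) * exp (- t)"
      by (simp flip: exp_add)
    moreover have "exp t * exp (- t) = 1"
      by (simp flip: exp_add)
    moreover have "(a + b) / 2 * (1 - b * b) = (a - b) / 2 * (1 + b * b)" if "a * b = 1" for a b :: real
    proof -
      have "a * (b * b) = b"
        using that by (simp flip: mult.assoc)
      thus ?thesis by (simp add: field_simps)
    qed
    ultimately have "cosh t * (1 - ?e) = sinh t * (1 + ?e)"
      by (simp only: cosh_field_def sinh_field_def)
    hence coth: "cosh t / sinh t = (1 + ?e) / (1 - ?e)"
      using st e1 by (simp add: frac_eq_eq mult.commute)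
    \<comment> \<open>The terms on the left are the derivatives of the four terms of \<open>h\<close>.\<close>
    have "2 * (t / sinh t * cosh t) - (2 * ln (1 - ?e) + 2 * t * (2 * ?e / (1 - ?e))) - 2 * t
            + (- ln (1 - ?e) / ?e) * (- 2 * ?e)
          = 2 * t * (cosh t / sinh t - 2 * ?e / (1 - ?e) - 1)"
      by (simp add: algebra_simps)
    also have "cosh t / sinh t - 2 * ?e / (1 - ?e) - 1 = 0"
      unfolding coth using e1 by (simp add: divide_simps)
    finally have zero: "2 * (t / sinh t * cosh t) - (2 * ln (1 - ?e) + 2 * t * (2 * ?e / (1 - ?e))) - 2 * t
            + (- ln (1 - ?e) / ?e) * (- 2 * ?e) = 0" by simp
    have ln': "((\<lambda>t. 2 * t * ln (1 - exp (- 2 * t))) has_real_derivative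
            2 * ln (1 - ?e) + 2 * t * (2 * ?e / (1 - ?e))) (at t)"
      using e1 by (auto intro!: derivative_eq_intros)
    have dl': "((\<lambda>t. dilog (exp (- 2 * t))) has_real_derivative (- ln (1 - ?e) / ?e) * (- 2 * ?e)) (at t)"
      using e1 by (intro dilog_has_real_derivative) (auto intro!: derivative_eq_intros)
    have sq': "((\<lambda>t. t\<^sup>2) has_real_derivative 2 * t) (at t)"
      by (auto intro!: derivative_eq_intros)
    show "(h has_real_derivative 0) (at t)"
      unfolding h_def
      by (rule DERIV_cong[OF _ zero])
         (intro DERIV_add DERIV_diff DERIV_cmult gs ln' dl' sq')
  next
    have "isCont g (sinh 0)"
      using DERIV_isCont[OF g] by simp
    hence "isCont (\<lambda>t. g (sinh t)) 0"
      by (rule isCont_o2[OF isCont_sinh_real])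
    hence 1: "((\<lambda>t. g (sinh t)) \<longlongrightarrow> g (sinh 0)) (at_right 0)"
      by (rule isCont_imp_at_right) simp
    have 2: "((\<lambda>t::real. 2 * t * ln (1 - exp (- 2 * t))) \<longlongrightarrow> 0) (at_right 0)"
      by real_asymp
    have 3: "((\<lambda>t::real. t\<^sup>2) \<longlongrightarrow> 0\<^sup>2) (at_right 0)"
      by (intro tendsto_intros)
    have "eventually (\<lambda>t::real. t \<in> {0<..<1}) (at_right 0)"
      by (intro eventually_at_right_real) auto
    hence "eventually (\<lambda>t::real. exp (- 2 * t) \<in> {-1..1}) (at_right 0)"
      by eventually_elim (auto intro: order_trans[of "-1" 0])
    hence 4: "((\<lambda>t. dilog (exp (- 2 * t))) \<longlongrightarrow> dilog 1) (at_right 0)"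
      by (intro tendsto_dilog_compose) (auto intro!: tendsto_eq_intros)
    show "(h \<longlongrightarrow> 2 * g (sinh 0) - 0 - 0\<^sup>2 + dilog 1) (at_right 0)"
      unfolding h_def by (intro tendsto_add tendsto_diff tendsto_mult_left 1 2 3 4)
  qed (use assms in \<open>simp_all add: sinh_less_1_iff\<close>)
  thus ?thesis
    by (simp add: h_def g_def dilog_1)
qed

definition pi_sq_summand :: "nat \<Rightarrow> real" where
  "pi_sq_summand n = arsinh_coeff n / ((2 * real n + 1)\<^sup>2 * 4 ^ n)"

text \<open>
  At \<open>t = - ln r\<close>, where \<open>r\<close> is the inverse of the golden ratio, \<open>1 / r = 1 + r\<close> gives \<open>sinh t = 1/2\<close>,
  and \<open>1 - exp (- 2 * t) = r\<close> turns the logarithm into \<open>- t\<close>.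
\<close>

lemma pi_sq_summand_sums: "pi_sq_summand sums (pi\<^sup>2 / 10)"
proof -
  define r :: real where "r = (sqrt 5 - 1) / 2"
  have r: "0 < r" "r\<^sup>2 = 1 - r"
    by (auto simp: r_def power2_eq_square field_simps)
  have rr: "r * (1 + r) = 1"
    using r by (simp add: algebra_simps power2_eq_square)
  hence inv: "inverse r = 1 + r"
    using r by (simp add: field_simps)
  have r1: "r < 1"
    using r zero_less_power[of r 2] by linarith
  define t where "t = - ln r"
  have t: "0 < t"
    using r r1 by (simp add: t_def)
  have st: "sinh t = 1 / 2"
    using r by (simp add: t_def sinh_ln_real inv)
  have "exp (- 2 * t) = exp (ln r) * exp (ln r)"
    by (simp add: t_def flip: exp_add)
  hence e: "exp (- 2 * t) = r\<^sup>2"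
    using r(1) by (simp add: power2_eq_square)
  have eq: "arsinh_coeff n / real (2 * n + 1) / real (2 * n + 1) * (1 / 4) ^ n = pi_sq_summand n" for n
    by (simp add: pi_sq_summand_def power2_eq_square power_divide add_ac)
  have "summable (\<lambda>n. arsinh_coeff n / real (2 * n + 1) / real (2 * n + 1) * (1 / 4) ^ n)"
    by (intro summable_divide_odd summable_arsinh_coeff) auto
  hence sm: "summable pi_sq_summand"
    unfolding eq .
  have sq: "(sinh t)\<^sup>2 = 1 / 4"
    by (simp add: st power2_eq_square)
  have "suminf pi_sq_summand = 2 * t * ln (1 - r\<^sup>2) + t\<^sup>2 - dilog (r\<^sup>2) + pi\<^sup>2 / 6"
    using sinh_times_powser_odd_square[OF t, unfolded sq e eq] by (simp add: st)
  also have "1 - r\<^sup>2 = r"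
    using r by simp
  also have "dilog (r\<^sup>2) = pi\<^sup>2 / 15 - t\<^sup>2"
    using dilog_golden[OF r] by (simp add: t_def)
  also have "ln r = - t"
    by (simp add: t_def)
  also have "2 * t * - t + t\<^sup>2 - (pi\<^sup>2 / 15 - t\<^sup>2) + pi\<^sup>2 / 6 = pi\<^sup>2 / 10"
    by (simp add: power2_eq_square)
  finally show ?thesis
    using sm by (simp add: sums_iff)
qed

section \<open>Pairing consecutive terms\<close>

lemma arsinh_coeff_Suc:
  "arsinh_coeff (Suc n) = - (2 * real n + 1) / (2 * real n + 2) * arsinh_coeff n"
  using gbinomial_mult_1[of "-1/2 :: real" n] by (simp add: arsinh_coeff_def field_simps)

text \<open>
  Both sides satisfy the same first-order recurrence in \<open>n\<close>: raising \<open>n\<close> by one applies the functional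
  equation of the Gamma function twice in the numerator, which matches two steps of the
  recurrence for the binomial coefficients.
\<close>

lemma Gamma_quotient:
  "Gamma (2 * real n + 1 / 2) / (Gamma (real n + 3 / 2) * fact n) * (1 / 64) ^ n
     = 2 * arsinh_coeff (2 * n) / ((2 * real n + 1) * 16 ^ n)"
proof (induction n)
  case 0
  have "(1 / 2 :: real) \<notin> \<int>\<^sub>\<le>\<^sub>0"
    by (auto elim!: nonpos_Ints_cases)
  from Gamma_plus1[OF this] have "sqrt pi = 2 * Gamma (3 / 2 :: real)"
    by (simp add: Gamma_one_half_real)
  moreover have "Gamma (3 / 2 :: real) \<noteq> 0"
    by (rule less_imp_neq[THEN not_sym], rule Gamma_real_pos) simp
  ultimately show ?case
    by (simp add: arsinh_coeff_def Gamma_one_half_real)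
next
  case (Suc n)
  let ?x = "real n"
  let ?q = "(2 * ?x + 3 / 2) * (2 * ?x + 1 / 2) / (64 * (?x + 3 / 2) * (?x + 1))"
  have pos: "y \<notin> \<int>\<^sub>\<le>\<^sub>0" if "y > 0" for y :: real
    using that by (auto elim!: nonpos_Ints_cases)
  have num: "Gamma (2 * real (Suc n) + 1 / 2) = (2 * ?x + 3 / 2) * (2 * ?x + 1 / 2) * Gamma (2 * ?x + 1 / 2)"
    using Gamma_plus1[OF pos, of "2 * ?x + 1 / 2"] Gamma_plus1[OF pos, of "2 * ?x + 3 / 2"]
    by (simp add: algebra_simps)
  have den: "Gamma (real (Suc n) + 3 / 2) = (?x + 3 / 2) * Gamma (?x + 3 / 2)"
    using Gamma_plus1[OF pos, of "?x + 3 / 2"] by (simp add: algebra_simps)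
  have "Gamma (2 * real (Suc n) + 1 / 2) / (Gamma (real (Suc n) + 3 / 2) * fact (Suc n)) * (1 / 64) ^ Suc n
      = ?q * (Gamma (2 * ?x + 1 / 2) / (Gamma (?x + 3 / 2) * fact n) * (1 / 64) ^ n)"
    unfolding num den by (simp add: add.commute mult_ac)
  also have "\<dots> = ?q * (2 * arsinh_coeff (2 * n) / ((2 * ?x + 1) * 16 ^ n))"
    by (simp only: Suc.IH)
  also have "\<dots> = 2 * arsinh_coeff (2 * Suc n) / ((2 * real (Suc n) + 1) * 16 ^ Suc n)"
    by (simp add: arsinh_coeff_Suc divide_simps) (simp add: algebra_simps)
  finally show ?case .
qed

text \<open>
  By \<open>arsinh_coeff_Suc\<close> the odd-indexed summand is a rational multiple of the even-indexed one, so the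
  claim reduces to an identity of rational functions of \<open>n\<close>, in which the double pole at
  \<open>4 * n + 1 = 0\<close> comes from the even index and the one at \<open>4 * n + 3 = 0\<close> from the odd index.
\<close>

lemma pi_sq_term_eq: "pi_sq_term n = 16 * (pi_sq_summand (2 * n) + pi_sq_summand (Suc (2 * n)))"
proof -
  let ?x = "real n"
  define c where "c = arsinh_coeff (2 * n)"
  define P where "P = 4 * ?x * (4 * ?x * (12 * ?x + 29) + 81) + 71"
  have nz: "2 * ?x + 1 \<noteq> 0" "4 * ?x + 1 \<noteq> 0" "4 * ?x + 3 \<noteq> 0"
    by linarith+
  have "pi_sq_term n = P / ((4 * ?x + 1)\<^sup>2 * (4 * ?x + 3)\<^sup>2) *
      (Gamma (2 * ?x + 1 / 2) / (Gamma (?x + 3 / 2) * fact n) * (1 / 64) ^ n)"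
    by (simp add: pi_sq_term_def P_def mult_ac)
  also have "\<dots> = P / ((4 * ?x + 1)\<^sup>2 * (4 * ?x + 3)\<^sup>2) * (2 * c / ((2 * ?x + 1) * 16 ^ n))"
    by (simp only: Gamma_quotient c_def)
  also have "\<dots> = c / 16 ^ n * (2 * P / ((4 * ?x + 1)\<^sup>2 * (4 * ?x + 3)\<^sup>2 * (2 * ?x + 1)))"
    by (simp add: mult_ac)
  also have "2 * P / ((4 * ?x + 1)\<^sup>2 * (4 * ?x + 3)\<^sup>2 * (2 * ?x + 1)) =
      16 / (4 * ?x + 1)\<^sup>2 - 2 * (4 * ?x + 1) / ((2 * ?x + 1) * (4 * ?x + 3)\<^sup>2)"
    using nz by (simp add: P_def divide_simps) (simp add: algebra_simps power2_eq_square)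
  also have "c / 16 ^ n * \<dots> = 16 * (pi_sq_summand (2 * n) + pi_sq_summand (Suc (2 * n)))"
  proof -
    have "pi_sq_summand (2 * n) = c / 16 ^ n * (1 / (4 * ?x + 1)\<^sup>2)"
      by (simp add: pi_sq_summand_def c_def power_mult)
    moreover have "pi_sq_summand (Suc (2 * n)) =
        - (c / 16 ^ n * ((4 * ?x + 1) / ((2 * ?x + 1) * (4 * ?x + 3)\<^sup>2)) / 8)"
      using nz by (simp add: pi_sq_summand_def c_def power_mult arsinh_coeff_Suc divide_simps)
                  (simp add: algebra_simps)
    moreover have "a * (16 / u - 2 * v / w) = 16 * (a * (1 / u) + - (a * (v / w) / 8))" for a u v w :: real
      by (simp add: right_diff_distrib mult.commute mult.left_commute)
    ultimately show ?thesis by (simp only:)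
  qed
  finally show ?thesis .
qed

theorem mainTheorem2:
  shows "summable pi_sq_term \<and> pi\<^sup>2 / 10 = 1 / 16 * (\<Sum>n. pi_sq_term n)"
proof -
  have "(\<lambda>n. sum pi_sq_summand {n * 2..<n * 2 + 2}) sums (pi\<^sup>2 / 10)"
    by (rule sums_group[OF pi_sq_summand_sums]) simp
  also have "(\<lambda>n. sum pi_sq_summand {n * 2..<n * 2 + 2}) =
      (\<lambda>n. pi_sq_summand (2 * n) + pi_sq_summand (Suc (2 * n)))"
    by (simp add: numeral_2_eq_2 mult.commute)
  finally have "(\<lambda>n. 16 * (pi_sq_summand (2 * n) + pi_sq_summand (Suc (2 * n)))) sums (16 * (pi\<^sup>2 / 10))"
    by (rule sums_mult)
  hence "pi_sq_term sums (16 * (pi\<^sup>2 / 10))"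
    by (simp only: flip: pi_sq_term_eq)
  thus ?thesis
    by (simp add: sums_iff)
qed

end
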